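(* Let $\Lambda\geqslant 2$ and $\lambda\geqslant\Lambda/(\Lambda-1)$ be real numbers. Then there is no $\lambda$-lacunary sequence of positive integers $(n_i)_{i=1}^{\infty}$ such that $n_{i+1}>\Lambda n_i$ for infinitely many indices $i\in\mathbb{N}$ and such that the set $P((1/n_i)_{i=1}^{\infty})$ contains all rational numbers from the interval $[0,\sum_{i=1}^{\infty}1/n_i)$.
   Context: $\mathbb{N}=\{1,2,3,\ldots\}$. For a real $\lambda>1$, a sequence $(n_i)_{i=1}^{\infty}$ of positive integers is called $\lambda$-lacunary if $n_{i+1}/n_i\geqslant\lambda$ for every $i\in\mathbb{N}$. For a sequence of positive reals $(x_i)_{i=1}^{\infty}$ one denotes \[ P((x_i)_{i=1}^{\infty}) := \Big\{ \sum_{i\in T} x_i \,:\, T\subset\mathbb{N} \text{ finite} \Big\} \] (the empty set $T$ is allowed and gives the sum $0$). *)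

theory Defs
  imports "HOL-Analysis.Analysis"
begin

(* Sequences are indexed from 0: the value at 0 is the first term of the sequence. *)

definition lacunary :: "real \<Rightarrow> (nat \<Rightarrow> nat) \<Rightarrow> bool" where
  "lacunary lam n \<longleftrightarrow> lam > 1 \<and> (\<forall>i. n i > 0) \<and> (\<forall>i. real (n (Suc i)) / real (n i) \<ge> lam)"

definition subsums :: "(nat \<Rightarrow> real) \<Rightarrow> real set" where
  "subsums x = {\<Sum>i\<in>T. x i | T. finite T}"

end

theory Submission
  imports Defs
begin

text \<open>
  The obstruction appears at an index \<open>i\<close> with \<open>n (Suc i) > \<Lambda> * n i\<close>. By lacunarity the
  reciprocals after index \<open>i\<close> are dominated by a geometric series, so together they sum to at most
  \<open>(1 / n (Suc i)) * lam / (lam - 1)\<close>. The hypothesis \<open>lam \<ge> \<Lambda> / (\<Lambda> - 1)\<close> says precisely that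
  \<open>lam / (lam - 1) \<le> \<Lambda>\<close>; hence this tail is at most \<open>\<Lambda> / n (Suc i)\<close>, which is smaller than
  \<open>1 / n i\<close>. A subsum that uses some index \<open>j \<le> i\<close> is at least \<open>1 / n j \<ge> 1 / n i\<close>, and any other
  subsum is bounded by the tail. So no subsum lies strictly between \<open>\<Lambda> / n (Suc i)\<close> and \<open>1 / n i\<close>,
  although this interval contains a rational number and lies below the full sum.
\<close>

lemma lacunary_growth:
  assumes "lacunary lam n"
  shows "real (n m) * lam ^ k \<le> real (n (m + k))"
proof (induction k)
  case 0
  show ?case by simp
next
  case (Suc k)
  have "lam > 1" "n (m + k) > 0" "real (n (Suc (m + k))) / real (n (m + k)) \<ge> lam"
    using assms by (auto simp: lacunary_def)
  then have step: "real (n (m + k)) * lam \<le> real (n (m + Suc k))"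
    by (simp add: field_simps)
  have "real (n m) * lam ^ Suc k = (real (n m) * lam ^ k) * lam"
    by simp
  also have "\<dots> \<le> real (n (m + k)) * lam"
    using Suc.IH \<open>lam > 1\<close> by (intro mult_right_mono) auto
  finally show ?case
    using step by linarith
qed

lemma lacunary_mono:
  assumes "lacunary lam n" and "i \<le> j"
  shows "n i \<le> n j"
proof -
  have "1 \<le> lam ^ (j - i)"
    using assms(1) by (intro one_le_power) (auto simp: lacunary_def)
  then have "real (n i) \<le> real (n i) * lam ^ (j - i)"
    by (simp add: mult_le_cancel_left1)
  then show ?thesis
    using lacunary_growth[OF assms(1), of i "j - i"] assms(2) by simp
qed

lemma lacunary_inverse_le_geometric:
  assumes "lacunary lam n"
  shows "1 / real (n (m + k)) \<le> (1 / real (n m)) * (1 / lam) ^ k"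
proof -
  have "n m > 0" "lam > 1"
    using assms by (auto simp: lacunary_def)
  then have "1 / real (n (m + k)) \<le> 1 / (real (n m) * lam ^ k)"
    by (intro divide_left_mono lacunary_growth[OF assms]) (use assms in \<open>auto simp: lacunary_def\<close>)
  then show ?thesis
    by (simp add: power_one_over)
qed

lemma lacunary_geometric_sums:
  assumes "lacunary lam n"
  shows "(\<lambda>k. (1 / real (n m)) * (1 / lam) ^ k) sums ((1 / real (n m)) * (lam / (lam - 1)))"
proof -
  have "lam > 1"
    using assms by (auto simp: lacunary_def)
  then have "(\<lambda>k. (1 / lam) ^ k) sums (1 / (1 - 1 / lam))"
    by (intro geometric_sums) auto
  also have "1 / (1 - 1 / lam) = lam / (lam - 1)"
    using \<open>lam > 1\<close> by (simp add: field_simps)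
  finally show ?thesis
    by (rule sums_mult)
qed

lemma lacunary_summable:
  assumes "lacunary lam n"
  shows "summable (\<lambda>i. 1 / real (n i))"
  using lacunary_inverse_le_geometric[OF assms, of 0]
  by (intro summable_comparison_test'[OF sums_summable[OF lacunary_geometric_sums[OF assms, of 0]]])
     auto

lemma lacunary_tail_le:
  assumes "lacunary lam n" and "finite T" and "T \<subseteq> {m..}"
  shows "(\<Sum>i\<in>T. 1 / real (n i)) \<le> (1 / real (n m)) * (lam / (lam - 1))"
proof -
  have "lam > 1"
    using assms(1) by (auto simp: lacunary_def)
  have "(\<Sum>i\<in>T. 1 / real (n i)) \<le> (\<Sum>i\<in>T. (1 / real (n m)) * (1 / lam) ^ (i - m))"
  proof (rule sum_mono)
    fix i assume "i \<in> T"
    then have "m + (i - m) = i"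
      using assms(3) by auto
    then show "1 / real (n i) \<le> (1 / real (n m)) * (1 / lam) ^ (i - m)"
      using lacunary_inverse_le_geometric[OF assms(1), of m "i - m"] by simp
  qed
  also have "\<dots> = (\<Sum>k\<in>(\<lambda>i. i - m) ` T. (1 / real (n m)) * (1 / lam) ^ k)"
    using assms(3) by (subst sum.reindex) (auto intro!: inj_on_diff_nat)
  also have "\<dots> \<le> (\<Sum>k. (1 / real (n m)) * (1 / lam) ^ k)"
    using assms(2) \<open>lam > 1\<close>
    by (intro sum_le_suminf sums_summable[OF lacunary_geometric_sums[OF assms(1)]]) auto
  also have "\<dots> = (1 / real (n m)) * (lam / (lam - 1))"
    by (rule sums_unique[OF lacunary_geometric_sums[OF assms(1)], symmetric])
  finally show ?thesis .
qed

text \<open>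
  The dichotomy is whether the subsum uses an index up to \<open>i\<close>. If \<open>n (Suc i) / n i\<close> exceeds
  \<open>lam / (lam - 1)\<close>, the two bounds leave an interval free of subsums.
\<close>

lemma lacunary_subsums_gap:
  assumes "lacunary lam n" and "s \<in> subsums (\<lambda>i. 1 / real (n i))"
  shows "s \<le> (1 / real (n (Suc i))) * (lam / (lam - 1)) \<or> 1 / real (n i) \<le> s"
proof -
  obtain T where T: "finite T" "s = (\<Sum>j\<in>T. 1 / real (n j))"
    using assms(2) by (auto simp: subsums_def)
  show ?thesis
  proof (cases "T \<subseteq> {Suc i..}")
    case True
    then show ?thesis
      using lacunary_tail_le[OF assms(1) T(1)] T(2) by blast
  next
    case False
    then obtain j where j: "j \<in> T" "j \<le> i"
      by (metis atLeast_iff not_less_eq_eq subsetI)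
    have "n j > 0"
      using assms(1) by (auto simp: lacunary_def)
    then have "1 / real (n i) \<le> 1 / real (n j)"
      using lacunary_mono[OF assms(1) j(2)] by (intro divide_left_mono) auto
    also have "\<dots> \<le> s"
      unfolding T(2) using T(1) j(1) by (intro member_le_sum) auto
    finally show ?thesis ..
  qed
qed

theorem mainTheorem4:
  fixes \<Lambda> lam :: real
  assumes "\<Lambda> \<ge> 2" and "lam \<ge> \<Lambda> / (\<Lambda> - 1)"
  shows "\<not> (\<exists>n :: nat \<Rightarrow> nat.
            lacunary lam n
          \<and> infinite {i. real (n (Suc i)) > \<Lambda> * real (n i)}
          \<and> \<rat> \<inter> {0..<(\<Sum>i. 1 / real (n i))} \<subseteq> subsums (\<lambda>i. 1 / real (n i)))"
proof
  assume "\<exists>n :: nat \<Rightarrow> nat.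
            lacunary lam n
          \<and> infinite {i. real (n (Suc i)) > \<Lambda> * real (n i)}
          \<and> \<rat> \<inter> {0..<(\<Sum>i. 1 / real (n i))} \<subseteq> subsums (\<lambda>i. 1 / real (n i))"
  then obtain n where lac: "lacunary lam n"
    and inf: "infinite {i. real (n (Suc i)) > \<Lambda> * real (n i)}"
    and sub: "\<rat> \<inter> {0..<(\<Sum>i. 1 / real (n i))} \<subseteq> subsums (\<lambda>i. 1 / real (n i))"
    by blast
  obtain i where i: "real (n (Suc i)) > \<Lambda> * real (n i)"
    using infinite_imp_nonempty[OF inf] by blast
  have "lam > 1" and pos: "n i > 0" "n (Suc i) > 0"
    using lac by (auto simp: lacunary_def)
  have "lam / (lam - 1) \<le> \<Lambda>"
    using assms \<open>lam > 1\<close> by (simp add: field_simps)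
  then have tail: "(1 / real (n (Suc i))) * (lam / (lam - 1)) \<le> \<Lambda> / real (n (Suc i))"
    using pos divide_right_mono[of "lam / (lam - 1)" \<Lambda> "real (n (Suc i))"] by (simp add: mult.commute)
  have "\<Lambda> / real (n (Suc i)) < 1 / real (n i)"
    using i pos by (simp add: field_simps)
  then obtain q where q: "q \<in> \<rat>" "\<Lambda> / real (n (Suc i)) < q" "q < 1 / real (n i)"
    using Rats_dense_in_real by blast
  have "0 \<le> \<Lambda> / real (n (Suc i))"
    using assms(1) by simp
  moreover have "1 / real (n i) \<le> (\<Sum>i. 1 / real (n i))"
    using sum_le_suminf[OF lacunary_summable[OF lac], of "{i}"] by simp
  ultimately have "q \<in> subsums (\<lambda>i. 1 / real (n i))"
    using sub q by auto
  from lacunary_subsums_gap[OF lac this, of i] show False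
    using tail q by linarith
qed

end
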